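(* Let $\beta\in(1,2)$. There is a constant $C>0$ (a normalising constant, making $\mu_\beta$ a probability measure) such that the absolutely continuous probability measure $\mu_\beta$ on $\left[0,\frac{1}{\beta-1}\right]$ has density with respect to Lebesgue measure given by \[ \rho_{\beta}(x)=C\sum_{n=0}^{\infty}\frac{1}{(2\beta)^n}\left(\sum_{\omega_1\cdots\omega_n\in\{0,1\}^n} \Big(\chi_{[0,R_{\beta,\omega_1\cdots\omega_n}^n(1)]}(x)+\chi_{[R_{\beta,\omega_1\cdots\omega_n}^n(\frac{1}{\beta-1}-1),\frac{1}{\beta-1}]}(x)\Big)\right). \]
   Context: Let $\beta\in(1,2)$, $I_\beta=\left[0,\frac1{\beta-1}\right]$, and partition $I_\beta$ into $L=\left[0,\frac1\beta\right)$, $S=\left[\frac1\beta,\frac1{\beta(\beta-1)}\right]$, $R=\left(\frac1{\beta(\beta-1)},\frac1{\beta-1}\right]$. Let $T_0(x)=\beta x$, $T_1(x)=\beta x-1$, let $\Omega=\{0,1\}^{\mathbb N}$ with left shift $\sigma$, and let $m_{1/2}$ be the $(\frac12,\frac12)$ Bernoulli measure on $\Omega$. The random $\beta$-transformation $K_\beta:\Omega\times I_\beta\to\Omega\times I_\beta$ is $K_\beta(\omega,x)=(\omega,T_0(x))$ if $x\in L$, $(\sigma(\omega),T_{\omega_1}(x))$ if $x\in S$, $(\omega,T_1(x))$ if $x\in R$. The associated skew product $R_\beta:\Omega\times I_\beta\to\Omega\times I_\beta$ is $R_\beta(\omega,x)=(\sigma(\omega),T_0(x))$ if $x\in L$, $(\sigma(\omega),T_{\omega_1}(x))$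 if $x\in S$, $(\sigma(\omega),T_1(x))$ if $x\in R$. $R^n_{\beta,\omega_1\cdots\omega_n}(x)$ denotes the second coordinate of $R_\beta^n(\omega,x)$, which depends on $\omega$ only through $\omega_1,\dots,\omega_n$; for $n=0$ the inner sum has a single term (the empty word) and $R^0_\beta(x)=x$. $\chi_A$ is the indicator function of $A$. Dajani and de Vries showed that there is a probability measure $\hat\mu_\beta=m_{1/2}\times\mu_\beta$ on $\Omega\times I_\beta$, with $\mu_\beta$ absolutely continuous with respect to Lebesgue measure, which is invariant and ergodic for $K_\beta$; it is also invariant under $R_\beta$. The measure $\mu_\beta$ in the claim is this measure. *)

theory Defs
  imports "HOL-Probability.Probability"
begin

text \<open>
  The sequence space \<open>{0,1}\<^sup>\<nat>\<close> is the type \<^typ>\<open>bool stream\<close> (\<^const>\<open>False\<close> is the digit 0,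
  \<^const>\<open>True\<close> the digit 1); its left shift is \<^const>\<open>stl\<close> and the first digit is \<^const>\<open>shd\<close>.
\<close>

definition beta_interval :: "real \<Rightarrow> real set" where
  "beta_interval \<beta> = {0 .. 1 / (\<beta> - 1)}"

definition left_region :: "real \<Rightarrow> real set" where
  "left_region \<beta> = {0 ..< 1 / \<beta>}"

definition switch_region :: "real \<Rightarrow> real set" where
  "switch_region \<beta> = {1 / \<beta> .. 1 / (\<beta> * (\<beta> - 1))}"

definition right_region :: "real \<Rightarrow> real set" where
  "right_region \<beta> = {1 / (\<beta> * (\<beta> - 1)) <.. 1 / (\<beta> - 1)}"

definition beta_map :: "real \<Rightarrow> bool \<Rightarrow> real \<Rightarrow> real" where
  "beta_map \<beta> d x = \<beta> * x - of_bool d"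

text \<open>
  The two random maps are total functions; only their restrictions to
  \<open>UNIV \<times> beta_interval \<beta>\<close> matter, where the final \<open>else\<close> is exactly \<open>right_region \<beta>\<close>
  (see \<open>beta_interval_partition\<close>).
\<close>

definition K_beta :: "real \<Rightarrow> bool stream \<times> real \<Rightarrow> bool stream \<times> real" where
  "K_beta \<beta> = (\<lambda>(\<omega>, x).
     if x \<in> left_region \<beta> then (\<omega>, beta_map \<beta> False x)
     else if x \<in> switch_region \<beta> then (stl \<omega>, beta_map \<beta> (shd \<omega>) x)
     else (\<omega>, beta_map \<beta> True x))"

definition R_beta :: "real \<Rightarrow> bool stream \<times> real \<Rightarrow> bool stream \<times> real" where
  "R_beta \<beta> = (\<lambda>(\<omega>, x).
     if x \<in> left_region \<beta> then (stl \<omega>, beta_map \<beta> False x)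
     else if x \<in> switch_region \<beta> then (stl \<omega>, beta_map \<beta> (shd \<omega>) x)
     else (stl \<omega>, beta_map \<beta> True x))"

text \<open>
  \<open>R_word \<beta> w x\<close> is the second coordinate of the \<open>n\<close>-th iterate of \<open>R_beta \<beta>\<close> at
  \<open>(\<omega>, x)\<close>, for a sequence \<open>\<omega>\<close> starting with the word \<open>w\<close> of length \<open>n\<close>. The tail
  of \<open>\<omega>\<close> is irrelevant (see \<open>R_word_eq\<close>), so an arbitrary one is appended.
\<close>

definition R_word :: "real \<Rightarrow> bool list \<Rightarrow> real \<Rightarrow> real" where
  "R_word \<beta> w x = snd ((R_beta \<beta> ^^ length w) (w @- sconst False, x))"

definition coin_measure :: "bool stream measure" where
  "coin_measure = stream_space (measure_pmf (bernoulli_pmf (1/2)))"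

definition invariant_measure :: "'a measure \<Rightarrow> ('a \<Rightarrow> 'a) \<Rightarrow> bool" where
  "invariant_measure M T \<longleftrightarrow> T \<in> measurable M M \<and> distr M M T = M"

definition ergodic_measure :: "'a measure \<Rightarrow> ('a \<Rightarrow> 'a) \<Rightarrow> bool" where
  "ergodic_measure M T \<longleftrightarrow>
     invariant_measure M T \<and>
     (\<forall>A\<in>sets M. T -` A \<inter> space M = A \<longrightarrow> emeasure M A = 0 \<or> emeasure M (space M - A) = 0)"

text \<open>
  The Dajani--de Vries measure: an absolutely continuous Borel probability measure on the
  interval whose product with the fair coin measure is invariant and ergodic for \<open>K_beta \<beta>\<close>.
  Since the measure is a product, invariance under \<open>K_beta \<beta>\<close> and under \<open>R_beta \<beta>\<close>
  are the same condition, so the latter is not repeated.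
\<close>

definition dajani_de_vries_measure :: "real \<Rightarrow> real measure \<Rightarrow> bool" where
  "dajani_de_vries_measure \<beta> \<mu> \<longleftrightarrow>
     prob_space \<mu> \<and>
     sets \<mu> = sets (restrict_space borel (beta_interval \<beta>)) \<and>
     absolutely_continuous (restrict_space lborel (beta_interval \<beta>)) \<mu> \<and>
     ergodic_measure (coin_measure \<Otimes>\<^sub>M \<mu>) (K_beta \<beta>)"

definition density_series :: "real \<Rightarrow> real \<Rightarrow> real" where
  "density_series \<beta> x =
     (\<Sum>n. 1 / (2 * \<beta>) ^ n *
        (\<Sum>w\<in>{w :: bool list. length w = n}.
           indicator {0 .. R_word \<beta> w 1} x +
           indicator {R_word \<beta> w (1 / (\<beta> - 1) - 1) .. 1 / (\<beta> - 1)} x))"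

lemma beta_interval_partition:
  assumes "1 < \<beta>" "\<beta> < 2"
  shows "beta_interval \<beta> = left_region \<beta> \<union> switch_region \<beta> \<union> right_region \<beta>"
    and "left_region \<beta> \<inter> switch_region \<beta> = {}"
    and "left_region \<beta> \<inter> right_region \<beta> = {}"
    and "switch_region \<beta> \<inter> right_region \<beta> = {}"
proof -
  have "0 < 1 / \<beta>" using assms by simp
  moreover have "1 / \<beta> \<le> 1 / (\<beta> * (\<beta> - 1))"
    using assms by (simp add: field_simps)
  moreover have "1 / (\<beta> * (\<beta> - 1)) \<le> 1 / (\<beta> - 1)"
  proof (rule divide_left_mono)
    show "\<beta> - 1 \<le> \<beta> * (\<beta> - 1)"
      using assms mult_right_mono[of 1 \<beta> "\<beta> - 1"] by simp
  qed (use assms in auto)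
  ultimately show "beta_interval \<beta> = left_region \<beta> \<union> switch_region \<beta> \<union> right_region \<beta>"
    and "left_region \<beta> \<inter> switch_region \<beta> = {}"
    and "left_region \<beta> \<inter> right_region \<beta> = {}"
    and "switch_region \<beta> \<inter> right_region \<beta> = {}"
    unfolding beta_interval_def left_region_def switch_region_def right_region_def
    by (auto simp del: zero_less_divide_1_iff)
qed

lemma snd_R_beta_shift:
  "snd ((R_beta \<beta> ^^ length w) (w @- s, x)) = snd ((R_beta \<beta> ^^ length w) (w @- t, x))"
proof (induction w arbitrary: x)
  case (Cons d w)
  have step: "\<exists>y. \<forall>s. R_beta \<beta> ((d # w) @- s, x) = (w @- s, y)"
    by (auto simp: R_beta_def)
  then obtain y where "\<And>s. R_beta \<beta> ((d # w) @- s, x) = (w @- s, y)" by blast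
  then show ?case
    using Cons.IH[of y] by (simp only: list.size funpow_Suc_right add_Suc_right add_0_right o_apply)
qed simp

lemma R_word_eq: "R_word \<beta> w x = snd ((R_beta \<beta> ^^ length w) (w @- \<omega>, x))"
  unfolding R_word_def by (rule snd_R_beta_shift)

end

theory Submission
  imports Defs
begin

text \<open>
  Testing invariance on cylinders \<open>UNIV \<times> X\<close> shows that the density of \<open>\<mu>\<close> is a fixed point of the
  averaged transfer operator. The series is another fixed point: if \<open>F z\<close> is the sum of the indicators of
  \<open>[0, z]\<close> and of \<open>[b - z, b]\<close>, where \<open>b = 1 / (\<beta> - 1)\<close>, then the operator maps \<open>F z\<close> to
  \<open>1 / (2 \<beta>)\<close> times the sum of the two functions \<open>F z'\<close>, \<open>z'\<close> a random image of \<open>z\<close>, and of a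
  multiple of \<open>F 1\<close>. The multiples of \<open>F 1\<close> collected along the orbits of \<open>1\<close> are the digits of an
  expansion of \<open>1\<close>, so they telescope to exactly the term \<open>F 1\<close> that the operator has shifted away.

  Fixed points with equal integral coincide: the positive and the negative part of the difference
  \<open>u\<close> are again fixed, so \<open>{u > 0}\<close> and \<open>{u < 0}\<close> are forward invariant under the expanding
  affine branches. Blowing up small intervals in which such a set has density almost \<open>1\<close>
  shows that each of them, if not null, contains almost all of the switch region; as they
  are disjoint, one of them is null.
\<close>

section \<open>Sums over words as powers of one operator\<close>

definition R_step :: "real \<Rightarrow> bool \<Rightarrow> real \<Rightarrow> real" where
  "R_step \<beta> d x = (if x \<in> left_region \<beta> then \<beta> * x
     else if x \<in> switch_region \<beta> then \<beta> * x - of_bool d else \<beta> * x - 1)"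

text \<open>Both digits are summed, so the \<open>n\<close>-th power runs over all words of length
  \<open>n\<close>, and orbits can be handled by induction on \<open>n\<close> without mentioning
  words.\<close>

definition branch_sum :: "real \<Rightarrow> (real \<Rightarrow> real) \<Rightarrow> real \<Rightarrow> real" where
  "branch_sum \<beta> g y = g (R_step \<beta> False y) + g (R_step \<beta> True y)"

lemma R_word_Nil [simp]: "R_word \<beta> [] x = x"
  by (simp add: R_word_def)

lemma R_word_Cons: "R_word \<beta> (d # w) x = R_word \<beta> w (R_step \<beta> d x)"
proof -
  have "R_beta \<beta> ((d # w) @- sconst False, x) = (w @- sconst False, R_step \<beta> d x)"
    by (auto simp: R_beta_def R_step_def beta_map_def)
  then show ?thesis
    by (simp add: R_word_def funpow_Suc_right del: funpow.simps)
qed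

text \<open>The first digit of a word is the first one the skew product reads; splitting the words
  by it peels off one application of \<open>branch_sum\<close>.\<close>

lemma sum_words_eq_branch_sum:
  "(\<Sum>w | length w = n. g (R_word \<beta> w y)) = (branch_sum \<beta> ^^ n) g y"
proof (induction n arbitrary: y)
  case 0
  have "{w :: bool list. length w = 0} = {[]}" by auto
  then show ?case by simp
next
  case (Suc n)
  let ?W = "{w :: bool list. length w = n}"
  have fin: "finite ?W"
    using finite_lists_length_eq[of "UNIV :: bool set" n] by simp
  have "{w :: bool list. length w = Suc n} = (\<lambda>w. False # w) ` ?W \<union> (\<lambda>w. True # w) ` ?W"
  proof (intro set_eqI iffI)
    fix w :: "bool list" assume "w \<in> {w. length w = Suc n}"
    then obtain d v where "w = d # v" "length v = n" by (auto simp: length_Suc_conv)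
    then show "w \<in> (\<lambda>w. False # w) ` ?W \<union> (\<lambda>w. True # w) ` ?W" by (cases d) auto
  qed auto
  then have "(\<Sum>w | length w = Suc n. g (R_word \<beta> w y)) =
      (\<Sum>w\<in>?W. g (R_word \<beta> (False # w) y)) + (\<Sum>w\<in>?W. g (R_word \<beta> (True # w) y))"
    using fin by (simp, subst sum.union_disjoint) (auto simp: sum.reindex inj_on_def)
  then show ?case
    by (simp add: R_word_Cons Suc.IH branch_sum_def)
qed

lemma branch_sum_pow_mono:
  assumes "\<And>y. g y \<le> g' y"
  shows "(branch_sum \<beta> ^^ n) g y \<le> (branch_sum \<beta> ^^ n) g' y"
  by (induction n arbitrary: y) (auto simp: branch_sum_def assms intro: add_mono)

lemma branch_sum_pow_const: "(branch_sum \<beta> ^^ n) (\<lambda>_. a) y = 2 ^ n * a"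
  by (induction n arbitrary: y) (auto simp: branch_sum_def)

lemma branch_sum_pow_add:
  "(branch_sum \<beta> ^^ n) (\<lambda>z. g z + g' z) y = (branch_sum \<beta> ^^ n) g y + (branch_sum \<beta> ^^ n) g' y"
  by (induction n arbitrary: y) (auto simp: branch_sum_def)

lemma branch_sum_pow_cmult:
  "(branch_sum \<beta> ^^ n) (\<lambda>z. a * g z) y = a * (branch_sum \<beta> ^^ n) g y"
  by (induction n arbitrary: y) (auto simp: branch_sum_def algebra_simps)

lemma measurable_branch_sum_pow:
  assumes "\<And>z. F z \<in> borel_measurable M"
  shows "(\<lambda>x. (branch_sum \<beta> ^^ n) (\<lambda>z. F z x) y) \<in> borel_measurable M"
  by (induction n arbitrary: y) (auto simp: branch_sum_def assms)

section \<open>The interval, its regions and the reflection symmetry\<close>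

locale random_beta =
  fixes \<beta> :: real
  assumes \<beta>_gt_1: "1 < \<beta>" and \<beta>_less_2: "\<beta> < 2"
begin

definition b :: real where "b = 1 / (\<beta> - 1)"

lemma beta_b: "\<beta> * b = b + 1"
  using \<beta>_gt_1 by (simp add: b_def field_simps)

lemma b_gt_1: "1 < b"
  using \<beta>_gt_1 \<beta>_less_2 by (simp add: b_def field_simps)

lemma beta_interval_eq: "beta_interval \<beta> = {0..b}"
  by (simp add: beta_interval_def b_def)

lemma left_region_iff: "x \<in> left_region \<beta> \<longleftrightarrow> 0 \<le> x \<and> \<beta> * x < 1"
  using \<beta>_gt_1 by (auto simp: left_region_def field_simps)

lemma switch_region_iff: "x \<in> switch_region \<beta> \<longleftrightarrow> 1 \<le> \<beta> * x \<and> \<beta> * x \<le> b"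
  using \<beta>_gt_1 by (auto simp: switch_region_def b_def field_simps)

lemma right_region_iff: "x \<in> right_region \<beta> \<longleftrightarrow> b < \<beta> * x \<and> x \<le> b"
  using \<beta>_gt_1 by (auto simp: right_region_def b_def field_simps)

lemmas region_iff = left_region_iff switch_region_iff right_region_iff

lemma mult_le_b: "x \<le> b \<Longrightarrow> \<beta> * x \<le> b + 1"
  using \<beta>_gt_1 mult_left_mono[of x b \<beta>] by (simp add: beta_b)

lemma zero_le_beta_mult_iff: "0 \<le> \<beta> * x \<longleftrightarrow> 0 \<le> x"
  using \<beta>_gt_1 by (simp add: zero_le_mult_iff)

lemma R_step_in_interval:
  assumes "z \<in> {0..b}" shows "R_step \<beta> d z \<in> {0..b}"
  using assms mult_le_b[of z] zero_le_beta_mult_iff[of z] b_gt_1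
  by (auto simp: R_step_def region_iff of_bool_def)

lemma branch_sum_pow_cong:
  assumes "\<And>z. z \<in> {0..b} \<Longrightarrow> g z = g' z" "y \<in> {0..b}"
  shows "(branch_sum \<beta> ^^ n) g y = (branch_sum \<beta> ^^ n) g' y"
  using assms(2)
proof (induction n arbitrary: y)
  case (Suc n)
  then show ?case using R_step_in_interval by (auto simp: branch_sum_def)
qed (simp add: assms)

text \<open>By \<open>beta_b\<close>, \<open>\<beta> * (b - y) = b + 1 - \<beta> * y\<close>. The
  reflection exchanges the outer regions, keeps the switch region and swaps the two
  branches.\<close>

lemma R_step_reflect:
  assumes "y \<in> {0..b}" shows "R_step \<beta> d (b - y) = b - R_step \<beta> (\<not> d) y"
proof -
  have "\<beta> * (b - y) = b + 1 - \<beta> * y" by (simp add: right_diff_distrib beta_b)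
  then show ?thesis using assms b_gt_1
    by (auto simp: R_step_def region_iff)
qed

text \<open>The swap of digits disappears because \<open>branch_sum\<close> adds over both.\<close>

lemma branch_sum_pow_reflect:
  assumes "y \<in> {0..b}"
  shows "(branch_sum \<beta> ^^ n) g (b - y) = (branch_sum \<beta> ^^ n) (\<lambda>z. g (b - z)) y"
  using assms
proof (induction n arbitrary: y)
  case (Suc n)
  show ?case
    using Suc.IH[OF R_step_in_interval[OF Suc.prems], of False]
      Suc.IH[OF R_step_in_interval[OF Suc.prems], of True] R_step_reflect[OF Suc.prems]
    by (simp add: branch_sum_def)
qed simp

section \<open>The averaged transfer operator and its action on indicators\<close>

definition left_weight :: "real \<Rightarrow> real" where
  "left_weight x = indicator (left_region \<beta>) x + indicator (switch_region \<beta>) x / 2"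

definition right_weight :: "real \<Rightarrow> real" where
  "right_weight x = indicator (right_region \<beta>) x + indicator (switch_region \<beta>) x / 2"

text \<open>The Perron-Frobenius operator averaged over a fair coin: the weights are the
  probabilities of the two branches at the preimage, and \<open>1 / \<beta>\<close> is the Jacobian
  of the inverse branches.\<close>

definition transfer :: "(real \<Rightarrow> real) \<Rightarrow> real \<Rightarrow> real" where
  "transfer f x = (left_weight (x / \<beta>) * f (x / \<beta>) + right_weight ((x + 1) / \<beta>) * f ((x + 1) / \<beta>)) / \<beta>"

lemma mult_div_beta: "\<beta> * (x / \<beta>) = x"
  using \<beta>_gt_1 by simp

lemma div_beta_le_b: "(x + 1) / \<beta> \<le> b \<longleftrightarrow> x \<le> b"
  using \<beta>_gt_1 beta_b by (simp add: pos_divide_le_eq mult.commute)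

lemma left_weight_div:
  "left_weight (x / \<beta>) = (if 0 \<le> x \<and> x < 1 then 1 else if 1 \<le> x \<and> x \<le> b then 1 / 2 else 0)"
  using \<beta>_gt_1 by (auto simp: left_weight_def region_iff mult_div_beta indicator_def zero_le_divide_iff)

lemma right_weight_div:
  "right_weight ((x + 1) / \<beta>) = (if b - 1 < x \<and> x \<le> b then 1 else if 0 \<le> x \<and> x \<le> b - 1 then 1 / 2 else 0)"
  using \<beta>_gt_1 by (auto simp: right_weight_def region_iff mult_div_beta indicator_def div_beta_le_b)

lemma transfer_eq:
  "transfer f x = ((if 0 \<le> x \<and> x < 1 then 1 else if 1 \<le> x \<and> x \<le> b then 1 / 2 else 0) * f (x / \<beta>)
     + (if b - 1 < x \<and> x \<le> b then 1 else if 0 \<le> x \<and> x \<le> b - 1 then 1 / 2 else 0) * f ((x + 1) / \<beta>)) / \<beta>"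
  unfolding transfer_def left_weight_div right_weight_div ..

text \<open>The reflection swaps the two inverse branches together with their weights.\<close>

lemma transfer_reflect:
  assumes "x \<noteq> 1" "x \<noteq> b - 1"
  shows "transfer (\<lambda>y. f (b - y)) x = transfer f (b - x)"
proof -
  have e: "b - x / \<beta> = (b - x + 1) / \<beta>" "b - (x + 1) / \<beta> = (b - x) / \<beta>"
    using \<beta>_gt_1 beta_b by (simp_all add: field_simps)
  show ?thesis using assms b_gt_1
    unfolding transfer_eq e by auto
qed

text \<open>
  On the interval, \<open>excess z\<close> is the sum of the digits chosen by the two branches at \<open>z\<close>.
\<close>

definition excess :: "real \<Rightarrow> real" where
  "excess z = 2 * \<beta> * z - branch_sum \<beta> (\<lambda>y. y) z"

text \<open>What remains beyond \<open>branch_sum\<close> is the image \<open>[0, 1)\<close> of the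
  left region once \<open>z\<close> has passed it, and the mirror image of that interval once
  \<open>z\<close> has passed the switch region. The excluded points are the ends where these
  half-open intervals differ from the closed ones.\<close>

lemma transfer_indicator:
  assumes "z \<in> {0..b}" "x \<noteq> 1" "x \<noteq> b - 1"
  shows "transfer (indicator {0..z}) x = 
    (branch_sum \<beta> (\<lambda>y. indicator {0..y} x) z + of_bool (1 \<le> \<beta> * z) * indicator {0..1} x
      + of_bool (b < \<beta> * z) * indicator {0..1} (b - x)) / (2 * \<beta>)"
proof -
  have z: "0 \<le> \<beta> * z" "\<beta> * z \<le> b + 1" 
    using assms mult_le_b[of z] zero_le_beta_mult_iff[of z] by auto
  have e: "x / \<beta> \<le> z \<longleftrightarrow> x \<le> \<beta> * z" "(x + 1) / \<beta> \<le> z \<longleftrightarrow> x + 1 \<le> \<beta> * z" 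
    "0 \<le> x / \<beta> \<longleftrightarrow> 0 \<le> x"  "0 \<le> (x + 1) / \<beta> \<longleftrightarrow> 0 \<le> x + 1"
    using \<beta>_gt_1 by (simp_all add: field_simps zero_le_divide_iff)
  have eq: "a / \<beta> = a' / (2 * \<beta>) \<longleftrightarrow> 2 * a = a'" for a a'
    using \<beta>_gt_1 by (auto simp: field_simps)
  consider "\<beta> * z < 1" | "1 \<le> \<beta> * z" "\<beta> * z \<le> b" | "b < \<beta> * z" by linarith
  then show ?thesis
  proof cases
    case 1
    then show ?thesis using assms b_gt_1 z unfolding transfer_eq eq branch_sum_def R_step_def
      by (auto simp: region_iff e indicator_def)
  next
    case 2
    then show ?thesis using assms b_gt_1 z unfolding transfer_eq eq branch_sum_def R_step_def
      by (auto simp: region_iff e indicator_def)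
  next
    case 3
    then show ?thesis using assms b_gt_1 z unfolding transfer_eq eq branch_sum_def R_step_def
      by (auto simp: region_iff e indicator_def)
  qed
qed

lemma excess_eq:
  assumes "z \<in> {0..b}" shows "excess z = of_bool (1 \<le> \<beta> * z) + of_bool (b < \<beta> * z)"
  using assms b_gt_1 by (auto simp: excess_def branch_sum_def R_step_def region_iff)

text \<open>
  The second summand is the indicator of \<open>[b - z, b]\<close>; by the symmetry \<open>x \<mapsto> b - x\<close> of the branches
  the orbits of \<open>b - 1\<close> reduce to those of \<open>1\<close>.
\<close>

definition kernel :: "real \<Rightarrow> real \<Rightarrow> real" where
  "kernel z x = indicator {0..z} x + indicator {0..z} (b - x)"

lemma transfer_add: "transfer (\<lambda>y. f y + g y) x = transfer f x + transfer g x"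
  by (simp add: transfer_def algebra_simps add_divide_distrib)

lemma transfer_cmult: "transfer (\<lambda>y. a * f y) x = a * transfer f x"
  by (simp add: transfer_def algebra_simps)

text \<open>Adding the reflected identity exchanges the two correction terms of
  \<open>transfer_indicator\<close>, so together they become a multiple of the single function
  \<open>kernel 1\<close>.\<close>

lemma transfer_kernel:
  assumes "z \<in> {0..b}" "x \<noteq> 1" "x \<noteq> b - 1"
  shows "transfer (kernel z) x =
    (branch_sum \<beta> (\<lambda>y. kernel y x) z + excess z * kernel 1 x) / (2 * \<beta>)"
proof -
  have k: "kernel z = (\<lambda>x. indicator {0..z} x + indicator {0..z} (b - x))"
    by (simp add: kernel_def fun_eq_iff)
  have "transfer (\<lambda>x. indicator {0..z} (b - x)) x = transfer (indicator {0..z}) (b - x)"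
    using assms by (intro transfer_reflect)
  then have "transfer (kernel z) x =
      transfer (indicator {0..z}) x + transfer (indicator {0..z}) (b - x)"
    by (simp only: k transfer_add)
  moreover note transfer_indicator[OF assms]
  moreover have "transfer (indicator {0..z}) (b - x) =
      (branch_sum \<beta> (\<lambda>y. indicator {0..y} (b - x)) z + of_bool (1 \<le> \<beta> * z) * indicator {0..1} (b - x)
        + of_bool (b < \<beta> * z) * indicator {0..1} x) / (2 * \<beta>)"
    using transfer_indicator[of z "b - x"] assms by auto
  ultimately show ?thesis
    unfolding excess_eq[OF assms(1)] kernel_def branch_sum_def
    by (simp only: add_divide_distrib[symmetric]) (simp add: algebra_simps)
qed

section \<open>The series as a fixed point of the operator\<close>

definition series_term :: "nat \<Rightarrow> real \<Rightarrow> real" where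
  "series_term n x = (1 / (2 * \<beta>)) ^ n * (branch_sum \<beta> ^^ n) (\<lambda>z. kernel z x) 1"

lemma kernel_bounds: "0 \<le> kernel z x" "kernel z x \<le> 2"
  by (auto simp: kernel_def indicator_def)

text \<open>There are \<open>2 ^ n\<close> words and \<open>kernel\<close> is at most
  \<open>2\<close>; against \<open>(2 * \<beta>) ^ n\<close> this leaves a convergent geometric
  majorant.\<close>

lemma series_term_bounds: "0 \<le> series_term n x" "series_term n x \<le> 2 * (1 / \<beta>) ^ n"
proof -
  have "(branch_sum \<beta> ^^ n) (\<lambda>z. 0) 1 \<le> (branch_sum \<beta> ^^ n) (\<lambda>z. kernel z x) 1"
    by (rule branch_sum_pow_mono) (rule kernel_bounds)
  then show "0 \<le> series_term n x"
    using \<beta>_gt_1 by (simp add: series_term_def branch_sum_pow_const)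
  have "(branch_sum \<beta> ^^ n) (\<lambda>z. kernel z x) 1 \<le> (branch_sum \<beta> ^^ n) (\<lambda>z. 2) 1"
    by (rule branch_sum_pow_mono) (rule kernel_bounds)
  then show "series_term n x \<le> 2 * (1 / \<beta>) ^ n"
    using \<beta>_gt_1 by (simp add: series_term_def branch_sum_pow_const field_simps)
qed

lemma summable_bound: "summable (\<lambda>n. 2 * (1 / \<beta>) ^ n)"
  using \<beta>_gt_1 by (intro summable_mult summable_geometric) auto

lemma summable_series_term: "summable (\<lambda>n. series_term n x)"
  by (rule summable_comparison_test[OF _ summable_bound]) (use series_term_bounds in auto)

lemma density_series_eq: "density_series \<beta> x = (\<Sum>n. series_term n x)"
proof -
  have "1 / (2 * \<beta>) ^ n * (\<Sum>w\<in>{w :: bool list. length w = n}.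
           indicator {0 .. R_word \<beta> w 1} x +
           indicator {R_word \<beta> w (1 / (\<beta> - 1) - 1) .. 1 / (\<beta> - 1)} x) = series_term n x" for n
  proof -
    have "(\<Sum>w\<in>{w :: bool list. length w = n}.
           indicator {0 .. R_word \<beta> w 1} x +
           indicator {R_word \<beta> w (1 / (\<beta> - 1) - 1) .. 1 / (\<beta> - 1)} x) =
       (branch_sum \<beta> ^^ n) (\<lambda>z. indicator {0..z} x) 1
       + (branch_sum \<beta> ^^ n) (\<lambda>z. indicator {z..b} x) (b - 1)"
      by (simp only: sum.distrib b_def
          sum_words_eq_branch_sum[where g = "\<lambda>z. indicator {0..z} x"]
          sum_words_eq_branch_sum[where g = "\<lambda>z. indicator {z..1 / (\<beta> - 1)} x"])
    \<comment> \<open>The second family of orbits starts at \<open>b - 1\<close>, the mirror image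
      of \<open>1\<close>.\<close>
    also have "(branch_sum \<beta> ^^ n) (\<lambda>z. indicator {z..b} x) (b - 1)
        = (branch_sum \<beta> ^^ n) (\<lambda>z. indicator {b - z..b} x) 1"
      using b_gt_1 by (intro branch_sum_pow_reflect) auto
    also have "(\<lambda>z. indicator {b - z..b} x) = (\<lambda>z. indicator {0..z} (b - x) :: real)"
      by (auto simp: indicator_def fun_eq_iff)
    finally show ?thesis
      by (simp add: series_term_def kernel_def branch_sum_pow_add power_one_over)
  qed
  then show ?thesis by (simp add: density_series_def)
qed

text \<open>At a given \<open>x\<close> the operator evaluates the function at two points only, so
  pointwise summability is enough.\<close>

lemma transfer_suminf:
  assumes "\<And>y. summable (\<lambda>n. f n y)"
  shows "transfer (\<lambda>y. \<Sum>n. f n y) x = (\<Sum>n. transfer (f n) x)"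
  unfolding transfer_def
  by (intro sums_unique sums_divide sums_add sums_mult summable_sums assms)

text \<open>One operator acts on \<open>x\<close>, the other on the orbit variable, so additivity
  makes them commute.\<close>

lemma transfer_branch_sum_pow:
  "transfer (\<lambda>x. (branch_sum \<beta> ^^ n) (\<lambda>z. F z x) y) x = (branch_sum \<beta> ^^ n) (\<lambda>z. transfer (F z) x) y"
  by (induction n arbitrary: y) (auto simp: branch_sum_def transfer_add)

text \<open>This is the random expansion of \<open>1\<close> in base \<open>\<beta>\<close>,
  averaged over the coin.\<close>

lemma excess_sums:
  "(\<lambda>n. (1 / (2 * \<beta>)) ^ Suc n * (branch_sum \<beta> ^^ n) excess 1) sums 1"
proof -
  \<comment> \<open>\<open>d n\<close> is the mean of the \<open>n\<close>-th orbit points of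
    \<open>1\<close>, divided by \<open>\<beta> ^ n\<close>. It starts at \<open>1\<close> and tends
    to \<open>0\<close> because orbits stay in the interval.\<close>
  define d where "d n = (1 / (2 * \<beta>)) ^ n * (branch_sum \<beta> ^^ n) (\<lambda>y. y) 1" for n
  have one: "(1::real) \<in> {0..b}" using b_gt_1 by simp
  have bounds: "0 \<le> (branch_sum \<beta> ^^ n) (\<lambda>y. y) y \<and> (branch_sum \<beta> ^^ n) (\<lambda>y. y) y \<le> 2 ^ n * b"
    if "y \<in> {0..b}" for y n
    using that
  proof (induction n arbitrary: y)
    case (Suc n)
    from Suc.IH[OF R_step_in_interval[OF Suc.prems], of False]
      Suc.IH[OF R_step_in_interval[OF Suc.prems], of True]
    show ?case by (simp add: branch_sum_def)
  qed simp
  have d_bounds: "\<bar>d n\<bar> \<le> b * (1 / \<beta>) ^ n" for n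
    using bounds[OF one, of n] \<beta>_gt_1 by (simp add: d_def field_simps)
  have "(\<lambda>n. b * (1 / \<beta>) ^ n) \<longlonglongrightarrow> b * 0"
    using \<beta>_gt_1 by (intro tendsto_mult tendsto_const LIMSEQ_power_zero) auto
  then have "d \<longlonglongrightarrow> 0"
    by (intro Lim_null_comparison[of d "\<lambda>n. b * (1 / \<beta>) ^ n"]) (simp_all add: d_bounds)
  then have "(\<lambda>n. d n - d (Suc n)) sums (d 0 - 0)"
    by (rule telescope_sums')
  moreover have "d n - d (Suc n) = (1 / (2 * \<beta>)) ^ Suc n * (branch_sum \<beta> ^^ n) excess 1" for n
  proof -
    have "(branch_sum \<beta> ^^ n) excess 1 + (branch_sum \<beta> ^^ n) (branch_sum \<beta> (\<lambda>y. y)) 1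
        = 2 * \<beta> * (branch_sum \<beta> ^^ n) (\<lambda>y. y) 1"
      unfolding branch_sum_pow_cmult[symmetric] branch_sum_pow_add[symmetric]
      by (simp add: excess_def)
    then show ?thesis
      using \<beta>_gt_1 by (simp add: d_def funpow_Suc_right field_simps del: funpow.simps)
  qed
  ultimately show ?thesis by (simp add: d_def)
qed

lemma transfer_density_series:
  assumes "x \<noteq> 1" "x \<noteq> b - 1"
  shows "transfer (density_series \<beta>) x = density_series \<beta> x"
proof -
  let ?t = "1 / (2 * \<beta>)"
  have one: "(1::real) \<in> {0..b}" using b_gt_1 by simp
  have "transfer (series_term n) x
      = series_term (Suc n) x + ?t ^ Suc n * (branch_sum \<beta> ^^ n) excess 1 * kernel 1 x" for n
  proof -
    have "series_term n = (\<lambda>x. ?t ^ n * (branch_sum \<beta> ^^ n) (\<lambda>z. kernel z x) 1)"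
      by (simp add: series_term_def fun_eq_iff)
    then have "transfer (series_term n) x =
        ?t ^ n * (branch_sum \<beta> ^^ n) (\<lambda>z. transfer (kernel z) x) 1"
      by (simp only: transfer_cmult transfer_branch_sum_pow)
    also have "(branch_sum \<beta> ^^ n) (\<lambda>z. transfer (kernel z) x) 1 = (branch_sum \<beta> ^^ n)
        (\<lambda>z. ?t * (branch_sum \<beta> (\<lambda>y. kernel y x) z + kernel 1 x * excess z)) 1"
      \<comment> \<open>\<open>transfer_kernel\<close> holds for \<open>z\<close> in the interval
        only; this suffices because the orbits of \<open>1\<close> stay there.\<close>
      using assms by (intro branch_sum_pow_cong one) (simp add: transfer_kernel mult.commute)
    also have "\<dots> = ?t * ((branch_sum \<beta> ^^ Suc n) (\<lambda>z. kernel z x) 1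
        + kernel 1 x * (branch_sum \<beta> ^^ n) excess 1)"
      by (simp only: branch_sum_pow_cmult branch_sum_pow_add funpow_Suc_right o_apply)
    finally show ?thesis
      by (simp add: series_term_def[abs_def] algebra_simps del: funpow.simps)
  qed
  \<comment> \<open>The shifted series lacks its term \<open>0\<close>; the second part contributes
    exactly \<open>kernel 1 x\<close>, which is that term.\<close>
  moreover have "(\<lambda>n. series_term (Suc n) x + ?t ^ Suc n * (branch_sum \<beta> ^^ n) excess 1 * kernel 1 x)
      sums (((\<Sum>n. series_term n x) - series_term 0 x) + 1 * kernel 1 x)"
    by (intro sums_add sums_mult2 excess_sums)
      (simp add: sums_Suc_iff[of "\<lambda>n. series_term n x"] summable_sums summable_series_term)
  moreover have "series_term 0 x = kernel 1 x"
    by (simp add: series_term_def)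
  moreover have "density_series \<beta> = (\<lambda>y. \<Sum>n. series_term n y)"
    by (simp add: density_series_eq fun_eq_iff)
  ultimately show ?thesis
    using transfer_suminf[of series_term x] summable_series_term
    by (simp add: sums_iff)
qed

end

section \<open>Sets that are thin in every interval\<close>

text \<open>A weak form of the Lebesgue density theorem. A set of positive measure has a cover by
  non-overlapping intervals whose total length barely exceeds its measure, so it cannot miss a fixed
  proportion of each of them.\<close>

lemma measure_thin_set_eq_0:
  fixes A :: "real set"
  assumes A: "A \<in> sets borel" "A \<subseteq> {p..q}" and "0 \<le> k" "k < 1"
    and thin: "\<And>u v. u \<le> v \<Longrightarrow> measure lborel (A \<inter> {u..v}) \<le> k * (v - u)"
  shows "measure lborel A = 0"
proof (rule ccontr)
  let ?m = "measure lebesgue"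
  have lm: "X \<in> sets borel \<Longrightarrow> bounded X \<Longrightarrow> X \<in> lmeasurable" for X :: "real set"
    by (intro bounded_set_imp_lmeasurable) auto
  have bA: "bounded A" using A(2) by (rule bounded_subset[rotated]) simp
  have mA: "?m A = measure lborel A" using A by (simp add: measure_completion)
  assume "measure lborel A \<noteq> 0"
  then have pos: "0 < ?m A" by (simp add: mA less_le)
  \<comment> \<open>Half of the gap between \<open>k * ?m A\<close> and \<open>?m A\<close>, so that
    \<open>k * (?m A + e)\<close> stays below \<open>?m A\<close>.\<close>
  define e where "e = (1 - k) * ?m A / 2"
  have "0 < e" using pos \<open>k < 1\<close> by (simp add: e_def)
  obtain D where D: "countable D" "\<And>K. K \<in> D \<Longrightarrow> K \<subseteq> cbox p q \<and> K \<noteq> {} \<and> (\<exists>u v. K = cbox u v)"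
    and Dint: "pairwise (\<lambda>A B. interior A \<inter> interior B = {}) D"
    and AD: "A \<subseteq> \<Union>D" and Dm: "\<Union>D \<in> lmeasurable" "?m (\<Union>D) \<le> ?m A + e"
    by (rule measurable_outer_intervals_bounded[of A p q e]) (use A bA lm \<open>0 < e\<close> in auto)
  have Kint: "\<exists>u v. K = {u..v} \<and> u \<le> v" if "K \<in> D" for K
    using D(2)[OF that] by (metis atLeastatMost_empty_iff interval_cbox)
  have AK: "A \<inter> K \<in> lmeasurable" if "K \<in> D" for K
    using Kint[OF that] A(1) bA by (intro lm) auto
  have "?m (\<Union>K\<in>D. A \<inter> K) \<le> k * ?m (\<Union>D)"
  proof (rule measure_UN_bound[OF D(1)])
    show "A \<inter> K \<in> lmeasurable" if "K \<in> D" for K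
      using that by (rule AK)
    fix F assume F: "F \<subseteq> D" "finite F"
    have lmF: "K \<in> lmeasurable" if "K \<in> F" for K
      using Kint[of K] that F by auto
    \<comment> \<open>The members are convex, so intersections with empty interior are negligible
      and the lengths of finitely many members add up.\<close>
    have neg: "pairwise (\<lambda>K L. negligible (K \<inter> L)) F"
    proof (rule pairwiseI)
      fix K L assume that: "K \<in> F" "L \<in> F" "K \<noteq> L"
      have "K \<in> D" "L \<in> D" using F that by auto
      then obtain u v u' v' where "K = {u..v}" "L = {u'..v'}"
        using Kint by meson
      moreover have "interior (K \<inter> L) = {}"
        using Dint F that by (auto simp: pairwise_def)
      ultimately show "negligible (K \<inter> L)"
        using negligible_convex_interior[of "K \<inter> L"] by (simp add: convex_Int)
    qed
    have "?m (\<Union>K\<in>F. A \<inter> K) \<le> (\<Sum>K\<in>F. ?m (A \<inter> K))"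
      using F AK by (intro measure_UNION_le) (auto intro: fmeasurableD)
    also have "\<dots> \<le> (\<Sum>K\<in>F. k * ?m K)"
    proof (rule sum_mono)
      fix K assume "K \<in> F"
      then obtain u v where K: "K = {u..v}" "u \<le> v" using Kint F by blast
      then show "?m (A \<inter> K) \<le> k * ?m K"
        using thin[OF K(2)] A(1) by (simp add: measure_completion)
    qed
    also have "\<dots> = k * ?m (\<Union>F)"
      using measure_negligible_finite_Union[OF F(2) lmF neg]
      by (simp add: sum_distrib_left)
    also have "?m (\<Union>F) \<le> ?m (\<Union>D)"
      using F lmF Dm by (intro measure_mono_fmeasurable) (auto intro!: sets.finite_Union)
    finally show "?m (\<Union>K\<in>F. A \<inter> K) \<le> k * ?m (\<Union>D)"
      using \<open>0 \<le> k\<close> by (simp add: mult_left_mono)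
  qed
  moreover have "(\<Union>K\<in>D. A \<inter> K) = A" using AD by auto
  ultimately have "?m A \<le> k * (?m A + e)"
    using mult_left_mono[OF Dm(2) \<open>0 \<le> k\<close>] by simp
  also have "\<dots> < ?m A"
  proof -
    have "k * e \<le> e" using \<open>0 < e\<close> \<open>k < 1\<close> by simp
    moreover have "k * ?m A + e = ?m A - e" by (simp add: e_def field_simps)
    ultimately show ?thesis using \<open>0 < e\<close> by (simp only: distrib_left)
  qed
  finally show False by simp
qed

lemma fmeasurable_lborelI: "X \<in> sets borel \<Longrightarrow> bounded X \<Longrightarrow> X \<in> fmeasurable lborel"
  using emeasure_bounded_finite[of X] by (auto simp: fmeasurable_def)

section \<open>Duality and preservation of the integral\<close>

context random_beta
begin

lemma measurable_weights [measurable]: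
  "left_weight \<in> borel_measurable borel" "right_weight \<in> borel_measurable borel"
proof -
  have [measurable]: "left_region \<beta> \<in> sets borel" "switch_region \<beta> \<in> sets borel"
      "right_region \<beta> \<in> sets borel"
    by (simp_all add: left_region_def switch_region_def right_region_def)
  show "left_weight \<in> borel_measurable borel" "right_weight \<in> borel_measurable borel"
    unfolding left_weight_def[abs_def] right_weight_def[abs_def] by measurable
qed

lemma measurable_transfer [measurable (raw)]:
  assumes [measurable]: "f \<in> borel_measurable borel"
  shows "transfer f \<in> borel_measurable borel"
  unfolding transfer_def[abs_def] by measurable

lemma weights_bounds: "0 \<le> left_weight x" "left_weight x \<le> 1" "0 \<le> right_weight x" "right_weight x \<le> 1"
  using b_gt_1 by (auto simp: left_weight_def right_weight_def region_iff indicator_def)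

lemma weights_add: "x \<in> {0..b} \<Longrightarrow> left_weight x + right_weight x = 1"
  using b_gt_1 by (auto simp: left_weight_def right_weight_def region_iff indicator_def)

text \<open>Duality with the averaged composition operator: on each branch the affine substitution
  absorbs the factor \<open>1 / \<beta>\<close>. The bound on \<open>g\<close> secures
  integrability.\<close>

lemma integral_transfer:
  assumes f: "integrable lborel f" and g[measurable]: "g \<in> borel_measurable borel"
    and bound: "\<And>x. \<bar>g x\<bar> \<le> B"
  shows "integrable lborel (\<lambda>x. g x * transfer f x)"
    and "(\<integral>x. g x * transfer f x \<partial>lborel) =
      (\<integral>x. f x * (left_weight x * g (\<beta> * x) + right_weight x * g (\<beta> * x - 1)) \<partial>lborel)"
proof -
  have [measurable]: "f \<in> borel_measurable borel" using f by auto
  have \<beta>: "inverse \<beta> \<noteq> 0" "\<beta> \<noteq> 0" using \<beta>_gt_1 by auto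
  define l where "l x = left_weight x * f x * g (\<beta> * x)" for x
  define r where "r x = right_weight x * f x * g (\<beta> * x - 1)" for x
  have le: "\<bar>w * y * z\<bar> \<le> \<bar>B * y\<bar>" if "0 \<le> w" "w \<le> 1" "\<bar>z\<bar> \<le> B" for w y z :: real
  proof -
    have "w * \<bar>z\<bar> \<le> 1 * B" using that by (intro mult_mono) auto
    then have "w * \<bar>z\<bar> * \<bar>y\<bar> \<le> B * \<bar>y\<bar>" by (intro mult_right_mono) auto
    moreover have "0 \<le> B" using that(3) by linarith
    ultimately show ?thesis using that by (simp add: abs_mult mult_ac)
  qed
  have int: "integrable lborel l" "integrable lborel r"
    unfolding l_def[abs_def] r_def[abs_def]
    by (rule Bochner_Integration.integrable_bound[OF integrable_mult_right[OF f, of B]],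
        measurable, auto intro!: le weights_bounds bound)+
  have eq: "g x * transfer f x = (l (0 + inverse \<beta> * x) + r (inverse \<beta> + inverse \<beta> * x)) / \<beta>" for x
  proof -
    have "inverse \<beta> * x = x / \<beta>" "inverse \<beta> + inverse \<beta> * x = (x + 1) / \<beta>"
      by (simp_all add: divide_inverse algebra_simps)
    then show ?thesis
      using \<beta> by (simp add: l_def r_def transfer_def mult_div_beta algebra_simps add_divide_distrib)
  qed
  have int': "integrable lborel (\<lambda>x. l (0 + inverse \<beta> * x))"
      "integrable lborel (\<lambda>x. r (inverse \<beta> + inverse \<beta> * x))"
    using int \<beta> lborel_integrable_real_affine_iff by blast+
  show "integrable lborel (\<lambda>x. g x * transfer f x)"
    unfolding eq using int' by simp
  have "(\<integral>x. g x * transfer f x \<partial>lborel) =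
      ((\<integral>x. l (0 + inverse \<beta> * x) \<partial>lborel) + (\<integral>x. r (inverse \<beta> + inverse \<beta> * x) \<partial>lborel)) / \<beta>"
    unfolding eq using int' by simp
  also have "\<dots> = (\<integral>x. l x \<partial>lborel) + (\<integral>x. r x \<partial>lborel)"
    using lborel_integral_real_affine[OF \<beta>(1), of l 0]
      lborel_integral_real_affine[OF \<beta>(1), of r "inverse \<beta>"] \<beta>_gt_1
    by (simp add: field_simps)
  also have "\<dots> = (\<integral>x. l x + r x \<partial>lborel)"
    using int by simp
  finally show "(\<integral>x. g x * transfer f x \<partial>lborel) =
      (\<integral>x. f x * (left_weight x * g (\<beta> * x) + right_weight x * g (\<beta> * x - 1)) \<partial>lborel)"
    by (simp add: l_def r_def algebra_simps)
qed

lemma integrable_transfer: "integrable lborel f \<Longrightarrow> integrable lborel (transfer f)"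
  using integral_transfer(1)[of f "\<lambda>_. 1" 1] by simp

text \<open>Duality with the test function \<open>1\<close>, as the weights add up to
  \<open>1\<close> on the interval.\<close>

lemma integral_transfer_eq:
  assumes f: "integrable lborel f" and "\<And>x. x \<notin> {0..b} \<Longrightarrow> f x = 0"
  shows "(\<integral>x. transfer f x \<partial>lborel) = (\<integral>x. f x \<partial>lborel)"
proof -
  have "f x * (left_weight x + right_weight x) = f x" for x
    using assms(2)[of x] weights_add[of x] by (cases "x \<in> {0..b}") auto
  then have eq: "(\<lambda>x. f x * (left_weight x + right_weight x)) = f" by (rule ext)
  have "(\<integral>x. transfer f x \<partial>lborel) = (\<integral>x. f x * (left_weight x + right_weight x) \<partial>lborel)"
    using integral_transfer(2)[OF f, of "\<lambda>_. 1" 1] by simp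
  then show ?thesis unfolding eq .
qed

section \<open>Forward invariant sets of the expanding branches\<close>

text \<open>The map stretches lengths by \<open>\<beta>\<close>, so the preimage of
  \<open>X\<close>, almost contained in \<open>Y\<close>, has measure
  \<open>measure lborel X / \<beta>\<close>.\<close>

lemma measure_affine_preimage_le:
  assumes X: "X \<in> sets borel" "bounded X" and Y: "Y \<in> sets borel" "bounded Y"
    and sub: "AE x in lborel. t + \<beta> * x \<in> X \<longrightarrow> x \<in> Y"
  shows "measure lborel X \<le> \<beta> * measure lborel Y"
proof -
  have \<beta>: "\<beta> \<noteq> 0" using \<beta>_gt_1 by simp
  have int: "integrable lborel (indicator X :: real \<Rightarrow> real)" "integrable lborel (indicator Y :: real \<Rightarrow> real)"
    using X Y by (auto intro!: integrable_real_indicator emeasure_bounded_finite)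
  have "measure lborel X = (\<integral>x. indicator X x \<partial>lborel)" using X by simp
  also have "\<dots> = \<beta> * (\<integral>x. indicator X (t + \<beta> * x) \<partial>lborel)"
    using lborel_integral_real_affine[OF \<beta>, of "indicator X :: real \<Rightarrow> real" t] \<beta>_gt_1 by simp
  also have "(\<integral>x. indicator X (t + \<beta> * x) \<partial>lborel) \<le> (\<integral>x. indicator Y x \<partial>lborel :: real)"
    using sub by (intro integral_mono_AE lborel_integrable_real_affine int \<beta>)
      (auto simp: indicator_def)
  also have "\<dots> = measure lborel Y" using Y by simp
  finally show ?thesis using \<beta>_gt_1 by (simp add: mult_left_mono)
qed

lemma switch_region_subset: "switch_region \<beta> \<subseteq> {0..b}"
  and switch_region_eq: "switch_region \<beta> = {1 / \<beta> .. b / \<beta>}"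
proof -
  show eq: "switch_region \<beta> = {1 / \<beta> .. b / \<beta>}" by (simp add: switch_region_def b_def)
  have "b / \<beta> \<le> b" "0 \<le> 1 / \<beta>" using \<beta>_gt_1 b_gt_1 by (simp_all add: pos_divide_le_eq)
  then show "switch_region \<beta> \<subseteq> {0..b}"
    unfolding eq by (meson atLeastatMost_subset_iff)
qed

text \<open>
  The branches are affine, so blowing up a small interval does not increase the proportion of
  it outside \<open>A\<close>, until its image covers the switch region.
\<close>

lemma expand_interval:
  assumes A: "A \<in> sets borel" "A \<subseteq> {0..b}"
    and inv0: "AE x in lborel. x \<in> A \<and> \<beta> * x \<le> b \<longrightarrow> \<beta> * x \<in> A"
    and inv1: "AE x in lborel. x \<in> A \<and> 1 \<le> \<beta> * x \<longrightarrow> \<beta> * x - 1 \<in> A"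
    and J: "0 \<le> p" "p < q" "q \<le> b" "b < (q - p) * \<beta> ^ n"
  shows "measure lborel (switch_region \<beta> - A) * (q - p) \<le> b * measure lborel ({p..q} - A)"
  using J
proof (induction n arbitrary: p q)
  \<comment> \<open>Impossible: a subinterval of \<open>{0..b}\<close> is not longer than
    \<open>b\<close>.\<close>
  case 0
  then show ?case by simp
next
  case (Suc n)
  have S: "switch_region \<beta> \<in> sets borel" by (simp add: switch_region_eq)
  have bd: "bounded ({u..v} - A)" for u v
    by (rule bounded_subset[of "{u..v}"]) auto
  \<comment> \<open>Either a branch keeps the whole interval inside \<open>{0..b}\<close> and the
    induction hypothesis applies to the image, or the interval reaches beyond both ends of the
    switch region.\<close>
  consider "\<beta> * q \<le> b" | "1 \<le> \<beta> * p" | "\<beta> * p < 1" "b < \<beta> * q" by linarith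
  then show ?case
  proof cases
    case 1
    have "\<beta> * x \<le> b" if "x \<le> q" for x
    proof -
      have "\<beta> * x \<le> \<beta> * q" using that \<beta>_gt_1 by (intro mult_left_mono) auto
      then show ?thesis using 1 by linarith
    qed
    \<comment> \<open>By forward invariance, almost every point outside \<open>A\<close> in the
      image comes from a point outside \<open>A\<close>.\<close>
    then have "measure lborel ({\<beta> * p..\<beta> * q} - A) \<le> \<beta> * measure lborel ({p..q} - A)"
      using A inv0 1 \<beta>_gt_1
      by (intro measure_affine_preimage_le[where t = 0] bd) (auto elim!: eventually_mono)
    then have "b * measure lborel ({\<beta> * p..\<beta> * q} - A) \<le> \<beta> * (b * measure lborel ({p..q} - A))"
      using b_gt_1 by (simp add: mult.left_commute)
    moreover have "measure lborel (switch_region \<beta> - A) * (\<beta> * q - \<beta> * p)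
        \<le> b * measure lborel ({\<beta> * p..\<beta> * q} - A)"
      using Suc.prems 1 \<beta>_gt_1 by (intro Suc.IH) (auto simp: algebra_simps)
    ultimately have "\<beta> * (measure lborel (switch_region \<beta> - A) * (q - p))
        \<le> \<beta> * (b * measure lborel ({p..q} - A))"
      by (simp add: algebra_simps)
    then show ?thesis using \<beta>_gt_1 by simp
  next
    case 2
    have "measure lborel ({\<beta> * p - 1..\<beta> * q - 1} - A) \<le> \<beta> * measure lborel ({p..q} - A)"
      using A inv1 2 \<beta>_gt_1
      by (intro measure_affine_preimage_le[where t = "-1"] bd)
        (auto elim!: eventually_mono intro: order_trans mult_left_mono)
    then have "b * measure lborel ({\<beta> * p - 1..\<beta> * q - 1} - A) \<le> \<beta> * (b * measure lborel ({p..q} - A))"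
      using b_gt_1 by (simp add: mult.left_commute)
    moreover have "measure lborel (switch_region \<beta> - A) * ((\<beta> * q - 1) - (\<beta> * p - 1))
        \<le> b * measure lborel ({\<beta> * p - 1..\<beta> * q - 1} - A)"
      using Suc.prems 2 \<beta>_gt_1 mult_le_b[of q] by (intro Suc.IH) (auto simp: algebra_simps)
    ultimately have "\<beta> * (measure lborel (switch_region \<beta> - A) * (q - p))
        \<le> \<beta> * (b * measure lborel ({p..q} - A))"
      by (simp add: algebra_simps)
    then show ?thesis using \<beta>_gt_1 by simp
  next
    case 3
    then have "p \<le> 1 / \<beta>" "b / \<beta> \<le> q" using \<beta>_gt_1 by (simp_all add: field_simps)
    then have "switch_region \<beta> \<subseteq> {p..q}" by (auto simp: switch_region_eq)
    then have "measure lborel (switch_region \<beta> - A) \<le> measure lborel ({p..q} - A)"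
      using A(1) S by (intro measure_mono_fmeasurable fmeasurable_lborelI bd) auto
    then have "measure lborel (switch_region \<beta> - A) * (q - p) \<le> measure lborel ({p..q} - A) * b"
      using Suc.prems by (intro mult_mono) auto
    then show ?thesis by (simp add: mult.commute)
  qed
qed

text \<open>If \<open>A\<close> missed a part of the switch region of positive measure,
  \<open>expand_interval\<close> would make it miss a fixed proportion of every interval, and
  \<open>measure_thin_set_eq_0\<close> would make it null.\<close>

lemma switch_region_subset_invariant_set:
  assumes A: "A \<in> sets borel" "A \<subseteq> {0..b}"
    and inv0: "AE x in lborel. x \<in> A \<and> \<beta> * x \<le> b \<longrightarrow> \<beta> * x \<in> A"
    and inv1: "AE x in lborel. x \<in> A \<and> 1 \<le> \<beta> * x \<longrightarrow> \<beta> * x - 1 \<in> A"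
    and "measure lborel A \<noteq> 0"
  shows "measure lborel (switch_region \<beta> - A) = 0"
proof (rule ccontr)
  \<comment> \<open>The proportion of each interval that \<open>A\<close> misses, read off from
    \<open>expand_interval\<close>.\<close>
  define e where "e = measure lborel (switch_region \<beta> - A) / b"
  assume "measure lborel (switch_region \<beta> - A) \<noteq> 0"
  then have "0 < e" using b_gt_1 by (simp add: e_def less_le)
  have "measure lborel (switch_region \<beta> - A) \<le> measure lborel {0..b}"
  proof (intro measure_mono_fmeasurable fmeasurable_lborelI)
    show "switch_region \<beta> - A \<subseteq> {0..b}" using switch_region_subset by blast
    show "switch_region \<beta> - A \<in> sets lborel" using A(1) by (simp add: switch_region_eq)
  qed auto
  then have "e \<le> 1" using b_gt_1 by (simp add: e_def)
  have "measure lborel A = 0"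
  proof (rule measure_thin_set_eq_0[OF A])
    fix u v :: real assume "u \<le> v"
    \<comment> \<open>Clipping to \<open>{0..b}\<close> loses nothing of \<open>A\<close>.\<close>
    define p where "p = max u 0"
    define q where "q = min v b"
    have eq: "A \<inter> {u..v} = A \<inter> {p..q}" using A(2) by (auto simp: p_def q_def)
    show "measure lborel (A \<inter> {u..v}) \<le> (1 - e) * (v - u)"
    proof (cases "p < q")
      case True
      obtain n where "b / (q - p) < \<beta> ^ n"
        using real_arch_pow[OF \<beta>_gt_1] by blast
      then have "b < (q - p) * \<beta> ^ n" using True by (simp add: pos_divide_less_eq mult.commute)
      then have "measure lborel (switch_region \<beta> - A) * (q - p) \<le> b * measure lborel ({p..q} - A)"
        using True by (intro expand_interval[OF A inv0 inv1]) (auto simp: p_def q_def)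
      then have le: "e * (q - p) \<le> measure lborel ({p..q} - A)"
        using b_gt_1 by (simp add: e_def field_simps)
      have "measure lborel ({p..q} - A \<inter> {p..q}) = measure lborel {p..q} - measure lborel (A \<inter> {p..q})"
        using A(1) True by (intro measure_Diff) auto
      moreover have "{p..q} - A \<inter> {p..q} = {p..q} - A" by auto
      ultimately have "measure lborel (A \<inter> {p..q}) \<le> (1 - e) * (q - p)"
        using le True by (simp add: algebra_simps)
      also have "\<dots> \<le> (1 - e) * (v - u)"
        using \<open>e \<le> 1\<close> by (intro mult_left_mono) (auto simp: p_def q_def)
      finally show ?thesis by (simp add: eq)
    next
      case False
      then have "A \<inter> {p..q} \<subseteq> {p}" by auto
      then have "measure lborel (A \<inter> {p..q}) \<le> measure lborel {p}"
        using A(1) by (intro measure_mono_fmeasurable) (auto intro: fmeasurable_lborelI)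
      also have "\<dots> = 0" by simp
      also have "\<dots> \<le> (1 - e) * (v - u)" using \<open>e \<le> 1\<close> \<open>u \<le> v\<close> by simp
      finally show ?thesis by (simp add: eq)
    qed
  qed (use \<open>0 < e\<close> \<open>e \<le> 1\<close> in auto)
  with assms show False by simp
qed

section \<open>Uniqueness of fixed functions\<close>

text \<open>\<open>transfer v\<close> is a sum of nonnegative terms, hence positive at the images of
  a point where \<open>v\<close> is positive. As it equals \<open>v\<close> almost everywhere, the
  positivity set is forward invariant.\<close>

lemma support_of_fixed_function:
  assumes v: "v \<in> borel_measurable borel" "\<And>x. 0 \<le> v x" "\<And>x. x \<notin> {0..b} \<Longrightarrow> v x = 0"
    and fix_v: "AE x in lborel. transfer v x = v x"
    and pos: "measure lborel {x. 0 < v x} \<noteq> 0"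
  shows "measure lborel (switch_region \<beta> - {x. 0 < v x}) = 0"
proof (rule switch_region_subset_invariant_set)
  note [measurable] = v(1)
  have \<beta>: "\<beta> \<noteq> 0" using \<beta>_gt_1 by simp
  show "{x. 0 < v x} \<in> sets borel" by measurable
  show "{x. 0 < v x} \<subseteq> {0..b}" using v(3) by force
  have in_I: "x \<in> {0..b}" if "0 < v x" for x using v(3)[of x] that by force
  have transfer_pos: "0 < transfer v y" 
    if "0 < left_weight (y / \<beta>) * v (y / \<beta>) \<or> 0 < right_weight ((y + 1) / \<beta>) * v ((y + 1) / \<beta>)" for y
  proof -
    have "0 \<le> left_weight (y / \<beta>) * v (y / \<beta>)" "0 \<le> right_weight ((y + 1) / \<beta>) * v ((y + 1) / \<beta>)"
      by (simp_all add: weights_bounds v(2))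
    then have "0 < left_weight (y / \<beta>) * v (y / \<beta>) + right_weight ((y + 1) / \<beta>) * v ((y + 1) / \<beta>)"
      using that by linarith
    then show ?thesis using \<beta>_gt_1 by (simp add: transfer_def)
  qed
  have pred: "Measurable.pred borel (\<lambda>x. transfer v x = v x)" by measurable
  \<comment> \<open>The fixed point equation is needed at \<open>\<beta> * x\<close>; affine maps of
    nonzero slope pull null sets back to null sets.\<close>
  show "AE x in lborel. x \<in> {x. 0 < v x} \<and> \<beta> * x \<le> b \<longrightarrow> \<beta> * x \<in> {x. 0 < v x}"
    using AE_borel_affine[OF \<beta> pred fix_v, of 0]
  proof eventually_elim
    case (elim x)
    show ?case
    proof (intro impI)
      assume x: "x \<in> {x. 0 < v x} \<and> \<beta> * x \<le> b"
      then have "0 < left_weight x" using in_I[of x] b_gt_1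
        by (auto simp: left_weight_def region_iff indicator_def)
      then have "0 < transfer v (\<beta> * x)" using x \<beta> by (intro transfer_pos) auto
      then show "\<beta> * x \<in> {x. 0 < v x}" using elim by simp
    qed
  qed
  show "AE x in lborel. x \<in> {x. 0 < v x} \<and> 1 \<le> \<beta> * x \<longrightarrow> \<beta> * x - 1 \<in> {x. 0 < v x}"
    using AE_borel_affine[OF \<beta> pred fix_v, of "-1"]
  proof eventually_elim
    case (elim x)
    show ?case
    proof (intro impI)
      assume x: "x \<in> {x. 0 < v x} \<and> 1 \<le> \<beta> * x"
      then have "0 < right_weight x" using in_I[of x] b_gt_1
        by (auto simp: right_weight_def region_iff indicator_def)
      then have "0 < transfer v (\<beta> * x - 1)" using x \<beta> by (intro transfer_pos) auto
      then show "\<beta> * x - 1 \<in> {x. 0 < v x}" using elim by simp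
    qed
  qed
qed (rule pos)

lemma fixed_function_unique:
  assumes u: "integrable lborel u" "\<And>x. x \<notin> {0..b} \<Longrightarrow> u x = 0"
    and fix_u: "AE x in lborel. transfer u x = u x"
    and int0: "(\<integral>x. u x \<partial>lborel) = 0"
  shows "AE x in lborel. u x = 0"
proof -
  have [measurable]: "u \<in> borel_measurable borel" using u by auto
  let ?a = "\<lambda>x. \<bar>u x\<bar>"
  have ia: "integrable lborel ?a" using u by simp
  \<comment> \<open>The triangle inequality makes \<open>transfer ?a\<close> at least
    \<open>?a\<close>; their integrals agree, so they are equal almost everywhere.\<close>
  have le: "AE x in lborel. 0 \<le> transfer ?a x - ?a x"
    using fix_u
  proof eventually_elim
    case (elim x)
    have "\<bar>transfer u x\<bar> \<le> transfer ?a x"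
      using \<beta>_gt_1 weights_bounds
      by (auto simp: transfer_def abs_mult intro!: divide_right_mono order_trans[OF abs_triangle_ineq])
    then show ?case using elim by simp
  qed
  have "(\<integral>x. transfer ?a x - ?a x \<partial>lborel) = 0"
    using ia integrable_transfer[OF ia] integral_transfer_eq[OF ia] u(2) by simp
  then have fix_a: "AE x in lborel. transfer ?a x - ?a x = 0"
    using integral_nonneg_eq_0_iff_AE[OF _ le] ia integrable_transfer[OF ia] by simp
  \<comment> \<open>For \<open>s = 1\<close> and \<open>s = -1\<close> this is twice the positive
    and twice the negative part of \<open>u\<close>.\<close>
  define v where "v s x = \<bar>u x\<bar> + s * u x" for s x
  have v: "v s \<in> borel_measurable borel" "x \<notin> {0..b} \<Longrightarrow> v s x = 0" for s x
    by (auto simp: v_def[abs_def] u(2))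
  have v_nonneg: "0 \<le> v s x" if "\<bar>s\<bar> = 1" for s x
    using that by (auto simp: v_def abs_if split: if_splits)
  have fix_v: "AE x in lborel. transfer (v s) x = v s x" for s
    using fix_u fix_a
  proof eventually_elim
    case (elim x)
    have "transfer (v s) x = transfer ?a x + s * transfer u x"
      unfolding v_def[abs_def] transfer_add transfer_cmult ..
    then show ?case using elim by (simp add: v_def)
  qed
  \<comment> \<open>If one part is null, \<open>u\<close> has constant sign almost everywhere, and
    its vanishing integral forces it to be zero.\<close>
  have null: "AE x in lborel. u x = 0" if s: "\<bar>s\<bar> = 1" and 0: "measure lborel {x. 0 < v s x} = 0" for s
  proof -
    have "bounded {x. 0 < v s x}"
      by (rule bounded_subset[of "{0..b}"]) (use v(2) in force)+
    then have "emeasure lborel {x. 0 < v s x} = 0"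
      using 0 emeasure_bounded_finite[of "{x. 0 < v s x}"] by (simp add: emeasure_eq_ennreal_measure)
    then have "AE x in lborel. \<not> 0 < v s x"
      using v(1) by (subst AE_iff_measurable[OF _ refl]) auto
    then have "AE x in lborel. ?a x = - s * u x"
      using v_nonneg[OF s] by (auto simp: v_def elim!: eventually_mono) (smt (verit))
    then have "(\<integral>x. ?a x \<partial>lborel) = (\<integral>x. - s * u x \<partial>lborel)"
      by (intro integral_cong_AE) auto
    then have "(\<integral>x. ?a x \<partial>lborel) = 0" using int0 by simp
    then show ?thesis
      using integral_nonneg_eq_0_iff_AE[OF ia] by simp
  qed
  show ?thesis
  proof (cases "measure lborel {x. 0 < v 1 x} = 0 \<or> measure lborel {x. 0 < v (-1) x} = 0")
    case True
    then show ?thesis using null[of 1] null[of "-1"] by auto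
  next
    case False
    let ?S = "switch_region \<beta>"
    \<comment> \<open>No point lies in both supports, so their complements cover the switch region,
      which has positive length.\<close>
    have "?S = (?S - {x. 0 < v 1 x}) \<union> (?S - {x. 0 < v (-1) x})"
      by (auto simp: v_def)
    moreover have "measure lborel ((?S - {x. 0 < v 1 x}) \<union> (?S - {x. 0 < v (-1) x}))
        \<le> measure lborel (?S - {x. 0 < v 1 x}) + measure lborel (?S - {x. 0 < v (-1) x})"
      using v(1) by (intro measure_Un_le) (auto simp: switch_region_eq)
    moreover have "measure lborel (?S - {x. 0 < v s x}) = 0" if "s = 1 \<or> s = -1" for s
      using that False by (intro support_of_fixed_function v v_nonneg fix_v) auto
    ultimately have "measure lborel ?S \<le> 0" by simp
    moreover have "1 / \<beta> < b / \<beta>" using b_gt_1 \<beta>_gt_1 by (simp add: divide_strict_right_mono)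
    ultimately show ?thesis by (simp add: switch_region_eq)
  qed
qed

end

section \<open>The first digit under the coin measure\<close>

lemma space_coin_measure [simp]: "space coin_measure = UNIV"
  by (simp add: coin_measure_def space_stream_space)

lemma sets_coin_measure [measurable_cong]:
  "sets coin_measure = sets (stream_space (count_space UNIV))"
  unfolding coin_measure_def by (rule sets_stream_space_cong) simp

lemma prob_space_coin_measure: "prob_space coin_measure"
  unfolding coin_measure_def
  by (rule prob_space.prob_space_stream_space) (rule prob_space_measure_pmf)

lemma shd_sets_coin_measure: "{\<omega>. shd \<omega> = d} \<in> sets coin_measure"
proof -
  have "{\<omega> \<in> space (stream_space (count_space UNIV)). shd \<omega> = d} \<in> sets (stream_space (count_space UNIV))"
    by measurable
  then show ?thesis by (simp add: sets_coin_measure space_stream_space)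
qed

lemma measure_coin_shd: "measure coin_measure {\<omega>. shd \<omega> = d} = 1 / 2"
proof -
  interpret c: prob_space coin_measure by (rule prob_space_coin_measure)
  \<comment> \<open>Conditioned on the first digit \<open>t\<close>, the event is the whole space or
    empty.\<close>
  have "emeasure coin_measure {\<omega>. shd \<omega> = d} =
      (\<integral>\<^sup>+ t. emeasure coin_measure {\<omega>. t = d} \<partial>measure_pmf (bernoulli_pmf (1/2)))"
    using prob_space.emeasure_stream_space[OF prob_space_measure_pmf, of "{\<omega>. shd \<omega> = d}"] shd_sets_coin_measure[of d]
    by (simp add: coin_measure_def space_stream_space)
  also have "\<dots> = ennreal (1 / 2)"
    using c.emeasure_space_1 by (cases d) auto
  finally have eq: "emeasure coin_measure {\<omega>. shd \<omega> = d} = ennreal (1 / 2)" .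
  show ?thesis unfolding measure_def eq by (rule enn2real_ennreal) simp
qed

section \<open>Bounds for the series, and the density of the invariant measure\<close>

context random_beta
begin

lemma measurable_density_series: "density_series \<beta> \<in> borel_measurable borel"
proof -
  have [measurable]: "(\<lambda>x. kernel z x) \<in> borel_measurable borel" for z
    unfolding kernel_def by measurable
  have "series_term n \<in> borel_measurable borel" for n
    unfolding series_term_def[abs_def] by (intro borel_measurable_times borel_measurable_const
        measurable_branch_sum_pow) measurable
  then have "(\<lambda>x. \<Sum>n. series_term n x) \<in> borel_measurable borel"
    by (rule borel_measurable_suminf)
  then show ?thesis by (simp add: density_series_eq[abs_def])
qed

text \<open>Term \<open>0\<close> alone gives the lower bound, which makes the integral positive and
  normalisation possible; the upper bound serves integrability.\<close>

lemma density_series_bounds: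
  "indicator {0..1} x \<le> density_series \<beta> x" "density_series \<beta> x \<le> (\<Sum>n. 2 * (1 / \<beta>) ^ n)"
proof -
  have "(\<Sum>n\<in>{0}. series_term n x) \<le> (\<Sum>n. series_term n x)"
    by (rule sum_le_suminf) (auto simp: summable_series_term series_term_bounds)
  moreover have "indicator {0..1} x \<le> series_term 0 x"
    by (simp add: series_term_def kernel_def)
  ultimately show "indicator {0..1} x \<le> density_series \<beta> x"
    by (simp add: density_series_eq)
  show "density_series \<beta> x \<le> (\<Sum>n. 2 * (1 / \<beta>) ^ n)"
    unfolding density_series_eq
    by (intro suminf_le summable_series_term summable_bound series_term_bounds)
qed

lemma transfer_outside: "x \<notin> {0..b} \<Longrightarrow> transfer f x = 0"
  using b_gt_1 by (auto simp: transfer_eq)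

lemma weights_zero: "x \<notin> {0..b} \<Longrightarrow> left_weight x = 0 \<and> right_weight x = 0"
  using beta_interval_partition(1)[OF \<beta>_gt_1 \<beta>_less_2]
  by (auto simp: left_weight_def right_weight_def beta_interval_eq indicator_def)

text \<open>The weights vanish off the interval, so the operator sees only the values of
  \<open>f\<close> on it.\<close>

lemma transfer_restrict: "transfer (\<lambda>y. indicator {0..b} y * f y) x = transfer f x"
proof -
  have "left_weight y * (indicator {0..b} y * f y) = left_weight y * f y"
      "right_weight y * (indicator {0..b} y * f y) = right_weight y * f y" for y
    using weights_zero by (auto simp: indicator_def)
  then show ?thesis unfolding transfer_def by (simp only:)
qed

text \<open>Radon-Nikodym provides a density; invariance of the product measure and the duality in
  \<open>integral_transfer\<close> show that it is fixed.\<close>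

lemma dajani_de_vries_density:
  assumes "dajani_de_vries_measure \<beta> \<mu>"
  obtains f where "f \<in> borel_measurable borel" "\<And>x. 0 \<le> f x" "\<And>x. x \<notin> {0..b} \<Longrightarrow> f x = 0"
    "integrable lborel f" "(\<integral>x. f x \<partial>lborel) = 1" "AE x in lborel. transfer f x = f x"
    "\<mu> = density (restrict_space lborel {0..b}) (\<lambda>x. ennreal (f x))"
proof -
  let ?I = "{0..b}" and ?N = "restrict_space lborel {0..b}"
  from assms have prob: "prob_space \<mu>" and sets_\<mu>: "sets \<mu> = sets (restrict_space borel ?I)"
    and ac: "absolutely_continuous ?N \<mu>"
    and meas_K: "K_beta \<beta> \<in> measurable (coin_measure \<Otimes>\<^sub>M \<mu>) (coin_measure \<Otimes>\<^sub>M \<mu>)"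
    and inv: "distr (coin_measure \<Otimes>\<^sub>M \<mu>) (coin_measure \<Otimes>\<^sub>M \<mu>) (K_beta \<beta>) = coin_measure \<Otimes>\<^sub>M \<mu>"
    by (auto simp: dajani_de_vries_measure_def beta_interval_eq ergodic_measure_def invariant_measure_def)
  interpret \<mu>: prob_space \<mu> by (rule prob)
  interpret c: prob_space coin_measure by (rule prob_space_coin_measure)
  interpret M: pair_prob_space coin_measure \<mu> ..
  have space_\<mu>: "space \<mu> = ?I"
    using sets_eq_imp_space_eq[OF sets_\<mu>] by (simp add: space_restrict_space)
  have sets_\<mu>_iff: "X \<in> sets \<mu> \<longleftrightarrow> X \<in> sets borel \<and> X \<subseteq> ?I" for X
    by (auto simp: sets_\<mu> sets_restrict_space_iff)
  have sets_N: "sets \<mu> = sets ?N"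
    unfolding sets_\<mu> by (rule sets_restrict_space_cong) simp
  interpret N: finite_measure ?N
    using b_gt_1 by (intro finite_measureI) (simp add: emeasure_restrict_space space_restrict_space)
  obtain f' where f': "f' \<in> borel_measurable ?N" "density ?N f' = \<mu>"
    using N.Radon_Nikodym[OF ac sets_N] by auto
  \<comment> \<open>A real-valued version, extended by \<open>0\<close> so that integrals run over
    the whole line. \<open>enn2real\<close> alters \<open>f'\<close> only where it is infinite,
    which is a null set.\<close>
  define f where "f x = indicator ?I x * enn2real (f' x)" for x
  have f[measurable]: "f \<in> borel_measurable borel"
  proof -
    have "(\<lambda>x. enn2real (f' x)) \<in> borel_measurable ?N" using f'(1) by measurable
    then have "(\<lambda>x. indicator ?I x *\<^sub>R enn2real (f' x)) \<in> borel_measurable lborel"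
      by (subst (asm) borel_measurable_restrict_space_iff) auto
    then show ?thesis by (simp add: f_def[abs_def])
  qed
  have f_nonneg: "0 \<le> f x" and f_outside: "x \<notin> ?I \<Longrightarrow> f x = 0" for x
    by (auto simp: f_def)
  have "(\<integral>\<^sup>+x. f' x \<partial>?N) = (\<integral>\<^sup>+x. f' x * indicator (space ?N) x \<partial>?N)"
    by (intro nn_integral_cong) simp
  also have "\<dots> = emeasure (density ?N f') (space ?N)"
    using f'(1) by (intro emeasure_density[symmetric] sets.top)
  finally have "(\<integral>\<^sup>+x. f' x \<partial>?N) \<noteq> \<infinity>"
    using \<mu>.emeasure_space_1 space_\<mu> by (simp add: f'(2) space_restrict_space)
  then have "AE x in ?N. f' x \<noteq> \<infinity>"
    using f'(1) by (rule nn_integral_PInf_AE[rotated])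
  then have "AE x in ?N. f' x = ennreal (f x)"
    using AE_space by eventually_elim (simp add: f_def space_restrict_space less_top)
  then have \<mu>_eq: "\<mu> = density ?N (\<lambda>x. ennreal (f x))"
    unfolding f'(2)[symmetric] using f'(1) f
    by (intro density_cong) (auto intro!: measurable_restrict_space1)
  have em: "emeasure \<mu> X = (\<integral>\<^sup>+x. ennreal (f x * indicator X x) \<partial>lborel)"
    if "X \<in> sets borel" "X \<subseteq> ?I" for X
  proof -
    have "emeasure \<mu> X = (\<integral>\<^sup>+x. ennreal (f x) * indicator X x \<partial>?N)"
      using that f sets_N sets_\<mu>_iff[of X]
      by (subst \<mu>_eq, subst emeasure_density) (auto intro!: measurable_restrict_space1)
    also have "\<dots> = (\<integral>\<^sup>+x. ennreal (f x) * indicator X x * indicator ?I x \<partial>lborel)"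
      by (rule nn_integral_restrict_space) simp
    also have "\<dots> = (\<integral>\<^sup>+x. ennreal (f x * indicator X x) \<partial>lborel)"
      using that by (intro nn_integral_cong) (auto simp: indicator_def)
    finally show ?thesis .
  qed
  have "(\<integral>\<^sup>+x. ennreal (f x) \<partial>lborel) = (\<integral>\<^sup>+x. ennreal (f x * indicator ?I x) \<partial>lborel)"
    using f_outside by (intro nn_integral_cong) (auto simp: indicator_def)
  then have one: "(\<integral>\<^sup>+x. ennreal (f x) \<partial>lborel) = 1"
    using em[of ?I] \<mu>.emeasure_space_1 space_\<mu> by simp
  then have int: "integrable lborel f"
    using f_nonneg by (intro integrableI_nonneg) auto
  have int_X: "integrable lborel (\<lambda>x. f x * indicator X x)" if "X \<in> sets borel" for X
    using integrable_real_mult_indicator[of X lborel f] that int by simp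
  have m: "measure \<mu> X = (\<integral>x. f x * indicator X x \<partial>lborel)"
    if "X \<in> sets borel" "X \<subseteq> ?I" for X
    using em[OF that] int_X[OF that(1)] f_nonneg
    by (simp add: measure_def integral_eq_nn_integral)
  have total: "(\<integral>x. f x \<partial>lborel) = 1"
    using one f_nonneg by (simp add: integral_eq_nn_integral)
  have inv_X: "(\<integral>x. indicator X x * f x \<partial>lborel) = (\<integral>x. indicator X x * transfer f x \<partial>lborel)"
    if X: "X \<in> sets borel" "X \<subseteq> ?I" for X
  proof -
    let ?M = "coin_measure \<Otimes>\<^sub>M \<mu>"
    let ?L = "left_region \<beta>" and ?S = "switch_region \<beta>" and ?R = "right_region \<beta>"
    define X0 where "X0 = {x. \<beta> * x \<in> X}"
    define X1 where "X1 = {x. \<beta> * x - 1 \<in> X}"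
    note regions = beta_interval_partition[OF \<beta>_gt_1 \<beta>_less_2, unfolded beta_interval_eq]
    have dis: "x \<in> ?L \<Longrightarrow> x \<notin> ?S" "x \<in> ?L \<Longrightarrow> x \<notin> ?R" "x \<in> ?S \<Longrightarrow> x \<notin> ?R" for x
      using regions by blast+
    have X01: "X0 \<in> sets borel" "X1 \<in> sets borel"
    proof -
      note [measurable] = X(1)
      have "{x \<in> space borel. \<beta> * x \<in> X} \<in> sets borel" "{x \<in> space borel. \<beta> * x - 1 \<in> X} \<in> sets borel"
        by measurable
      then show "X0 \<in> sets borel" "X1 \<in> sets borel" by (simp_all add: X0_def X1_def)
    qed
    have borel_regions: "?L \<in> sets borel" "?S \<in> sets borel" "?R \<in> sets borel"
      by (simp_all add: left_region_def switch_region_def right_region_def)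
    have pieces: "X0 \<inter> ?L \<in> sets borel" "X0 \<inter> ?S \<in> sets borel" "X1 \<inter> ?S \<in> sets borel"
        "X1 \<inter> ?R \<in> sets borel" "X0 \<inter> ?L \<subseteq> ?I" "X0 \<inter> ?S \<subseteq> ?I" "X1 \<inter> ?S \<subseteq> ?I" "X1 \<inter> ?R \<subseteq> ?I"
      using X01 borel_regions regions(1) by auto
    have times: "measure ?M (A \<times> B) = measure coin_measure A * measure \<mu> B"
        "A \<times> B \<in> sets ?M"
      if "A \<in> sets coin_measure" "B \<in> sets borel" "B \<subseteq> ?I" for A B
      using that sets_\<mu>_iff by (auto simp: measure_def \<mu>.emeasure_pair_measure_Times enn2real_mult)
    have U: "UNIV \<in> sets coin_measure" using sets.top[of coin_measure] by simp
    let ?A = "UNIV \<times> (X0 \<inter> ?L) :: (bool stream \<times> real) set"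
    let ?B = "{\<omega>. shd \<omega> = False} \<times> (X0 \<inter> ?S)"
    let ?C = "{\<omega>. shd \<omega> = True} \<times> (X1 \<inter> ?S)"
    let ?D = "UNIV \<times> (X1 \<inter> ?R) :: (bool stream \<times> real) set"
    note ABCD = times(2)[OF U pieces(1,5)] times(2)[OF shd_sets_coin_measure[of False] pieces(2,6)]
      times(2)[OF shd_sets_coin_measure[of True] pieces(3,7)] times(2)[OF U pieces(4,8)]
    have "measure \<mu> X = measure ?M (UNIV \<times> X)"
      using times(1)[OF U X] c.prob_space by simp
    also have "\<dots> = measure (distr ?M ?M (K_beta \<beta>)) (UNIV \<times> X)"
      by (simp only: inv)
    also have "\<dots> = measure ?M (K_beta \<beta> -` (UNIV \<times> X) \<inter> space ?M)"
      using times(2)[OF U X] by (intro measure_distr meas_K)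
    \<comment> \<open>The coin restricts only the two pieces over the switch region; elsewhere the
      branch is determined by \<open>x\<close>.\<close>
    also have "K_beta \<beta> -` (UNIV \<times> X) \<inter> space ?M = ?A \<union> ?B \<union> ?C \<union> ?D"
    proof (intro set_eqI)
      fix y :: "bool stream \<times> real"
      obtain \<omega> x where y: "y = (\<omega>, x)" by (cases y)
      consider "x \<notin> ?I" | "x \<in> ?L" "x \<in> ?I" | "x \<in> ?S" "x \<in> ?I" | "x \<in> ?R" "x \<in> ?I"
        using regions(1) by blast
      then show "y \<in> K_beta \<beta> -` (UNIV \<times> X) \<inter> space ?M \<longleftrightarrow> y \<in> ?A \<union> ?B \<union> ?C \<union> ?D"
      proof cases
        case 1
        then have "x \<notin> ?L" "x \<notin> ?S" "x \<notin> ?R" using regions(1) by auto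
        then show ?thesis using 1 by (simp add: y space_pair_measure space_\<mu> del: atLeastAtMost_iff)
      qed (use dis in \<open>auto simp: y space_pair_measure space_\<mu> K_beta_def beta_map_def X0_def X1_def\<close>)
    qed
    also have "measure ?M \<dots> = measure ?M ?A + measure ?M ?B + measure ?M ?C + measure ?M ?D"
    proof -
      have "?A \<inter> ?B = {}" "(?A \<union> ?B) \<inter> ?C = {}" "(?A \<union> ?B \<union> ?C) \<inter> ?D = {}"
        using dis by auto
      then show ?thesis
        using ABCD by (simp only: M.finite_measure_Union sets.Un)
    qed
    also have "\<dots> = measure \<mu> (X0 \<inter> ?L) + measure \<mu> (X0 \<inter> ?S) / 2 + measure \<mu> (X1 \<inter> ?S) / 2
        + measure \<mu> (X1 \<inter> ?R)"
      using c.prob_space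
      by (simp only: times(1)[OF U] times(1)[OF shd_sets_coin_measure] pieces measure_coin_shd) simp
    also have "\<dots> = (\<integral>x. f x * indicator (X0 \<inter> ?L) x + f x * indicator (X0 \<inter> ?S) x / 2
        + f x * indicator (X1 \<inter> ?S) x / 2 + f x * indicator (X1 \<inter> ?R) x \<partial>lborel)"
      using pieces int_X by (simp add: m)
    \<comment> \<open>The four pieces recombine into the dual side of
      \<open>integral_transfer\<close> for the indicator of \<open>X\<close>.\<close>
    also have "\<dots> = (\<integral>x. f x * (left_weight x * indicator X (\<beta> * x)
        + right_weight x * indicator X (\<beta> * x - 1)) \<partial>lborel)"
      by (intro Bochner_Integration.integral_cong)
        (auto simp: left_weight_def right_weight_def X0_def X1_def indicator_def)
    also have "\<dots> = (\<integral>x. indicator X x * transfer f x \<partial>lborel)"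
      using X(1) by (intro integral_transfer(2)[OF int, of _ 1, symmetric]) (auto simp: indicator_def)
    finally show ?thesis using m[OF X] by (simp add: mult.commute)
  qed
  \<comment> \<open>Equal integrals over all Borel sets force equality almost everywhere; both
    functions vanish off the interval, so its subsets suffice.\<close>
  have "AE x in lborel. transfer f x = f x"
  proof (rule density_unique_real[OF integrable_transfer[OF int] int])
    fix A :: "real set" assume A: "A \<in> sets lborel"
    have eq: "(\<integral>x\<in>A. g x \<partial>lborel) = (\<integral>x. indicator (A \<inter> ?I) x * g x \<partial>lborel)"
      if "\<And>x. x \<notin> ?I \<Longrightarrow> g x = 0" for g :: "real \<Rightarrow> real"
      unfolding set_lebesgue_integral_def
      by (intro Bochner_Integration.integral_cong) (use that in \<open>auto simp: indicator_def\<close>)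
    have "(\<integral>x\<in>A. transfer f x \<partial>lborel) = (\<integral>x. indicator (A \<inter> ?I) x * transfer f x \<partial>lborel)"
      by (rule eq) (rule transfer_outside)
    also have "\<dots> = (\<integral>x. indicator (A \<inter> ?I) x * f x \<partial>lborel)"
      using A by (intro inv_X[symmetric]) auto
    also have "\<dots> = (\<integral>x\<in>A. f x \<partial>lborel)"
      by (rule eq[symmetric]) (rule f_outside)
    finally show "(\<integral>x\<in>A. transfer f x \<partial>lborel) = (\<integral>x\<in>A. f x \<partial>lborel)" .
  qed
  then show thesis
    using that f f_nonneg f_outside int total \<mu>_eq by blast
qed

end

section \<open>Comparison of the two fixed points\<close>

theorem theorem2p1:
  fixes \<beta> :: real and \<mu> :: "real measure"
  assumes "1 < \<beta>" and "\<beta> < 2"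
    and "dajani_de_vries_measure \<beta> \<mu>"
  shows "\<exists>C>0. \<mu> = density (restrict_space lborel (beta_interval \<beta>))
                          (\<lambda>x. ennreal (C * density_series \<beta> x))"
proof -
  interpret random_beta \<beta> using assms by unfold_locales
  let ?I = "{0..b}"
  obtain f where f: "f \<in> borel_measurable borel" "\<And>x. x \<notin> ?I \<Longrightarrow> f x = 0"
    "integrable lborel f" "(\<integral>x. f x \<partial>lborel) = 1" "AE x in lborel. transfer f x = f x"
    and \<mu>: "\<mu> = density (restrict_space lborel ?I) (\<lambda>x. ennreal (f x))"
    using dajani_de_vries_density[OF assms(3)] by metis
  note [measurable] = measurable_density_series f(1)
  \<comment> \<open>Uniqueness is stated for functions vanishing off the interval, so the series is
    cut down to it.\<close>
  define g where "g x = indicator ?I x * density_series \<beta> x" for x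
  define B where "B = (\<Sum>n. 2 * (1 / \<beta>) ^ n)"
  have nonneg: "0 \<le> density_series \<beta> x" for x
    using density_series_bounds(1)[of x] by (rule order_trans[OF indicator_pos_le])
  have int: "integrable lborel g"
  proof (rule Bochner_Integration.integrable_bound)
    show "integrable lborel (\<lambda>x. B * indicator ?I x)"
      using b_gt_1 by (intro integrable_mult_right integrable_real_indicator) auto
    show "g \<in> borel_measurable lborel" unfolding g_def[abs_def] by measurable
    show "AE x in lborel. norm (g x) \<le> norm (B * indicator ?I x)"
      using nonneg density_series_bounds(2)
      by (intro AE_I2) (auto simp: g_def B_def indicator_def intro: order_trans[OF _ abs_ge_self])
  qed
  have "1 = (\<integral>x. indicator {0..1::real} x \<partial>lborel :: real)" by simp
  also have "\<dots> \<le> (\<integral>x. g x \<partial>lborel)"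
  proof (rule integral_mono[OF _ int])
    show "indicator {0..1} x \<le> g x" for x
      using density_series_bounds(1)[of x] nonneg[of x] b_gt_1 by (auto simp: g_def indicator_def)
  qed simp
  finally have g_pos: "0 < (\<integral>x. g x \<partial>lborel)" by simp
  \<comment> \<open>With this constant \<open>C * g\<close> has integral \<open>1\<close>, like
    \<open>f\<close>.\<close>
  define C where "C = 1 / (\<integral>x. g x \<partial>lborel)"
  \<comment> \<open>The two points excluded in \<open>transfer_density_series\<close> form a null
    set.\<close>
  have "AE x in lborel. x \<noteq> 1 \<and> x \<noteq> b - 1"
    by (intro AE_conjI AE_lborel_singleton)
  then have fix_g: "AE x in lborel. transfer g x = g x"
  proof eventually_elim
    case (elim x)
    have "transfer g x = transfer (density_series \<beta>) x"
      unfolding g_def[abs_def] by (rule transfer_restrict)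
    then show ?case
      using elim transfer_outside[of x "density_series \<beta>"] transfer_density_series[of x]
      by (auto simp: g_def indicator_def)
  qed
  \<comment> \<open>The difference is a fixed function of integral \<open>0\<close>, written as a
    sum to fit \<open>transfer_add\<close> and \<open>transfer_cmult\<close>.\<close>
  have "AE x in lborel. f x + (- C) * g x = 0"
  proof (rule fixed_function_unique)
    show "AE x in lborel. transfer (\<lambda>x. f x + (- C) * g x) x = f x + (- C) * g x"
      using f(5) fix_g by eventually_elim (simp only: transfer_add transfer_cmult)
    show "(\<integral>x. f x + (- C) * g x \<partial>lborel) = 0"
      using f(3,4) int g_pos by (simp add: C_def)
    show "integrable lborel (\<lambda>x. f x + (- C) * g x)"
      using f(3) int by simp
  qed (use f(2) in \<open>simp add: g_def\<close>)
  then have "AE x in restrict_space lborel ?I. ennreal (f x) = ennreal (C * density_series \<beta> x)"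
    by (subst AE_restrict_space_iff) (auto simp: g_def elim!: eventually_mono)
  then have "\<mu> = density (restrict_space lborel ?I) (\<lambda>x. ennreal (C * density_series \<beta> x))"
    unfolding \<mu> by (intro density_cong measurable_restrict_space1) measurable
  moreover have "0 < C" using g_pos by (simp add: C_def)
  ultimately show ?thesis by (auto simp: beta_interval_eq)
qed

end
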